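(* Let $\dot G$ be a signed graph with spectrum $\{[-\lambda]^m,[0]^1,[\lambda]^m\}$ and suppose every vertex of its underlying graph $G$ has degree $\lambda^2$ or $\lambda^2-1$. Then there is a signed graph $\dot H$ with spectrum $\{[-\lambda]^{m+1},[\lambda]^{m+1}\}$ containing a vertex whose deletion yields $\dot G$ (i.e., $\dot G$ can be extended by one vertex to such a signed graph).
   Context: A signed graph $\dot G=(G,\sigma)$ consists of a simple graph $G$ and $\sigma:E(G)\to\{1,-1\}$; its adjacency matrix is that of $G$ with entries of negative edges replaced by $-1$, and its spectrum is the multiset of eigenvalues of this matrix. The notation $[\mu]^k$ means eigenvalue $\mu$ with multiplicity $k$. *)

theory Defs
  imports "Jordan_Normal_Form.Char_Poly" "HOL-Library.Multiset"
begin

text \<open>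
  Edges are two-element sets of vertices. The values of \<open>sign\<close> outside the edge set carry no
  meaning; no definition below depends on them.
\<close>

record 'a signed_graph =
  verts :: "'a set"
  edges :: "'a set set"
  sign :: "'a set \<Rightarrow> int"

definition is_signed_graph :: "'a signed_graph \<Rightarrow> bool" where
  "is_signed_graph G \<longleftrightarrow>
     finite (verts G) \<and>
     (\<forall>e\<in>edges G. e \<subseteq> verts G \<and> card e = 2) \<and>
     (\<forall>e\<in>edges G. sign G e \<in> {1, -1})"

definition vdegree :: "'a signed_graph \<Rightarrow> 'a \<Rightarrow> nat" where
  "vdegree G v = card {e \<in> edges G. v \<in> e}"

definition adj_matrix :: "'a signed_graph \<Rightarrow> 'a list \<Rightarrow> real mat" where
  "adj_matrix G vs = mat (length vs) (length vs)
     (\<lambda>(i, j). if {vs ! i, vs ! j} \<in> edges G then real_of_int (sign G {vs ! i, vs ! j}) else 0)"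

text \<open>
  The multiset of eigenvalues, with algebraic multiplicity. Real roots suffice, because the
  adjacency matrix is real symmetric. The chosen vertex ordering is irrelevant, see
  \<open>signed_spectrum_eq\<close>.
\<close>

definition signed_spectrum :: "'a signed_graph \<Rightarrow> real multiset" where
  "signed_spectrum G =
     proots (char_poly (adj_matrix G (SOME vs. distinct vs \<and> set vs = verts G)))"

definition delete_vertex :: "'a \<Rightarrow> 'a signed_graph \<Rightarrow> 'a signed_graph" where
  "delete_vertex v G =
     \<lparr> verts = verts G - {v}, edges = {e \<in> edges G. v \<notin> e}, sign = sign G \<rparr>"

text \<open>Isomorphism preserves every edge sign (no switching is allowed).\<close>

definition isomorphic :: "'a signed_graph \<Rightarrow> 'b signed_graph \<Rightarrow> bool" where
  "isomorphic G H \<longleftrightarrow>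
     (\<exists>f. bij_betw f (verts G) (verts H) \<and>
          edges H = (\<lambda>e. f ` e) ` edges G \<and>
          (\<forall>e\<in>edges G. sign H (f ` e) = sign G e))"

lemma similar_adj_matrix:
  fixes G :: "'a signed_graph"
  assumes vs: "distinct vs" and ws: "distinct ws" and eq: "set vs = set ws"
  shows "similar_mat (adj_matrix G vs) (adj_matrix G ws)"
proof -
  define n where "n = length vs"
  have n': "length ws = n"
    using vs ws eq unfolding n_def by (metis distinct_card)
  define Q where "Q = (\<lambda>(xs :: 'a list) (ys :: 'a list). mat n n (\<lambda>(i, j). if xs ! i = ys ! j then 1 else (0::real)))"
  have QQ: "Q xs ys * Q ys xs = 1\<^sub>m n"
    if xs: "distinct xs" "length xs = n" and ys: "distinct ys" "length ys = n"
      and seteq: "set xs = set ys" for xs ys :: "'a list"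
  proof (rule eq_matI)
    fix i j assume "i < dim_row (1\<^sub>m n :: real mat)" "j < dim_col (1\<^sub>m n :: real mat)"
    hence ij: "i < n" "j < n" by auto
    obtain k where k: "k < n" "ys ! k = xs ! i"
      using seteq ij xs ys in_set_conv_nth[of "xs ! i" ys] nth_mem[of i xs] by auto
    have "(Q xs ys * Q ys xs) $$ (i, j) =
        (\<Sum>l = 0..<n. (if xs ! i = ys ! l then 1 else 0) * (if ys ! l = xs ! j then 1 else 0))"
      using ij by (simp add: Q_def scalar_prod_def)
    also have "\<dots> = (\<Sum>l = 0..<n. if l = k then (if i = j then 1 else 0) else 0)"
    proof (rule sum.cong[OF refl])
      fix l assume l: "l \<in> {0..<n}"
      have *: "ys ! l = xs ! i \<longleftrightarrow> l = k"
        using l k ys nth_eq_iff_index_eq[of ys l k] by simp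
      have **: "xs ! i = xs ! j \<longleftrightarrow> i = j"
        using ij xs nth_eq_iff_index_eq[of xs i j] by simp
      show "(if xs ! i = ys ! l then 1 else 0) * (if ys ! l = xs ! j then 1 else 0) =
          (if l = k then (if i = j then 1 else 0) else (0::real))"
        using * ** k by (cases "l = k") (simp_all add: eq_commute[of "xs ! i" "ys ! l"])
    qed
    also have "\<dots> = 1\<^sub>m n $$ (i, j)" using k ij by simp
    finally show "(Q xs ys * Q ys xs) $$ (i, j) = 1\<^sub>m n $$ (i, j)" .
  qed (auto simp: Q_def)
  define A where "A = (\<lambda>xs. adj_matrix G xs)"
  have carr: "Q xs ys \<in> carrier_mat n n" for xs ys by (simp add: Q_def)
  have Ac: "A vs \<in> carrier_mat n n" "A ws \<in> carrier_mat n n"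
    by (simp_all add: A_def adj_matrix_def n_def n'[unfolded n_def])
  have comm: "A vs * Q vs ws = Q vs ws * A ws"
  proof (rule eq_matI)
    fix i j assume "i < dim_row (Q vs ws * A ws)" "j < dim_col (Q vs ws * A ws)"
    hence ij: "i < n" "j < n" using carr[of vs ws] Ac by auto
    obtain k where k: "k < n" "vs ! k = ws ! j"
      using eq ij n' n_def in_set_conv_nth[of "ws ! j" vs] nth_mem[of j ws] by auto
    obtain l where l: "l < n" "ws ! l = vs ! i"
      using eq ij n' n_def in_set_conv_nth[of "vs ! i" ws] nth_mem[of i vs] by auto
    let ?a = "\<lambda>u v. if {u, v} \<in> edges G then real_of_int (sign G {u, v}) else 0"
    have "(A vs * Q vs ws) $$ (i, j) =
        (\<Sum>r = 0..<n. ?a (vs ! i) (vs ! r) * (if vs ! r = ws ! j then 1 else 0))"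
      using ij by (simp add: A_def adj_matrix_def Q_def scalar_prod_def n_def)
    also have "\<dots> = (\<Sum>r = 0..<n. if r = k then ?a (vs ! i) (ws ! j) else 0)"
    proof (rule sum.cong[OF refl])
      fix r assume r: "r \<in> {0..<n}"
      have "vs ! r = ws ! j \<longleftrightarrow> r = k"
        using r k(1) vs nth_eq_iff_index_eq[of vs r k] unfolding k(2)[symmetric] n_def by simp
      thus "?a (vs ! i) (vs ! r) * (if vs ! r = ws ! j then 1 else 0) =
          (if r = k then ?a (vs ! i) (ws ! j) else 0)" using k by simp
    qed
    also have "\<dots> = ?a (vs ! i) (ws ! j)" using k by simp
    also have "\<dots> = (\<Sum>r = 0..<n. if r = l then ?a (vs ! i) (ws ! j) else 0)" using l by simp
    also have "\<dots> = (\<Sum>r = 0..<n. (if vs ! i = ws ! r then 1 else 0) * ?a (ws ! r) (ws ! j))"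
    proof (rule sum.cong[OF refl])
      fix r assume r: "r \<in> {0..<n}"
      have "vs ! i = ws ! r \<longleftrightarrow> r = l"
        using r l(1) ws n' nth_eq_iff_index_eq[of ws r l] unfolding l(2)[symmetric] by auto
      thus "(if r = l then ?a (vs ! i) (ws ! j) else 0) =
          (if vs ! i = ws ! r then 1 else 0) * ?a (ws ! r) (ws ! j)" using l by simp
    qed
    also have "\<dots> = (Q vs ws * A ws) $$ (i, j)"
      using ij n' by (simp add: A_def adj_matrix_def Q_def scalar_prod_def)
    finally show "(A vs * Q vs ws) $$ (i, j) = (Q vs ws * A ws) $$ (i, j)" .
  qed (use carr[of vs ws] Ac in auto)
  have inv1: "Q vs ws * Q ws vs = 1\<^sub>m n"
    by (rule QQ[OF vs n_def[symmetric] ws n' eq])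
  have inv2: "Q ws vs * Q vs ws = 1\<^sub>m n"
    by (rule QQ[OF ws n' vs n_def[symmetric] eq[symmetric]])
  have "A vs = A vs * (Q vs ws * Q ws vs)" using inv1 Ac by simp
  also have "\<dots> = Q vs ws * A ws * Q ws vs"
    by (simp only: assoc_mult_mat[OF Ac(1) carr carr, symmetric] comm)
  finally have "A vs = Q vs ws * A ws * Q ws vs" .
  hence "similar_mat (A vs) (A ws)"
    by (intro similar_matI[OF _ inv1 inv2]) (use Ac carr in blast)+
  thus ?thesis by (simp only: A_def)
qed

lemma signed_spectrum_eq:
  assumes "distinct vs" "set vs = verts G"
  shows "signed_spectrum G = proots (char_poly (adj_matrix G vs))"
proof -
  let ?ws = "SOME vs. distinct vs \<and> set vs = verts G"
  have "distinct ?ws \<and> set ?ws = verts G"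
    using assms by (intro someI[of "\<lambda>vs. distinct vs \<and> set vs = verts G"]) simp
  thus ?thesis
    unfolding signed_spectrum_def
    using char_poly_similar[OF similar_adj_matrix[of ?ws vs G]] assms by simp
qed

end

theory Submission
  imports Defs "Jordan_Normal_Form.Schur_Decomposition"
begin

text \<open>
  Let \<open>A\<close> be the adjacency matrix of \<open>G\<close> and \<open>R = \<lambda>\<^sup>2 I - A\<^sup>2\<close>. The spectrum says that \<open>R\<close> is
  \<open>\<lambda>\<^sup>2\<close> times the orthogonal projection onto the one-dimensional kernel of \<open>A\<close> (if \<open>\<lambda> \<noteq> 0\<close>), so
  \<open>R = b b\<^sup>T\<close> with \<open>A b = 0\<close> and \<open>b\<^sup>T b = \<lambda>\<^sup>2\<close>. The degree condition says that the diagonal entries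
  \<open>b\<^sub>i\<^sup>2\<close> of \<open>R\<close> are \<open>0\<close> or \<open>1\<close>, hence \<open>b\<close> is the row of signs of a new vertex. The bordered matrix
  squares to \<open>\<lambda>\<^sup>2 I\<close> and has trace \<open>0\<close>, which determines its spectrum.

  Diagonalization is avoided: for a real symmetric matrix the traces of its powers are the power
  sums of the spectrum, and a symmetric \<open>C\<close> with \<open>tr C\<^sup>2 = 0\<close> vanishes.
\<close>

subsection \<open>Traces of powers and the spectrum\<close>

definition mat_trace :: "'a :: comm_ring_1 mat \<Rightarrow> 'a" where
  "mat_trace A = (\<Sum>i<dim_row A. A $$ (i, i))"

lemma mat_trace_minus:
  assumes "A \<in> carrier_mat n n" "B \<in> carrier_mat n n"
  shows "mat_trace (A - B) = mat_trace A - mat_trace B"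
  using assms by (simp add: mat_trace_def sum_subtractf)

lemma mat_trace_smult:
  assumes "A \<in> carrier_mat n n"
  shows "mat_trace (c \<cdot>\<^sub>m A) = c * mat_trace A"
  using assms by (simp add: mat_trace_def sum_distrib_left)

lemma mat_trace_one: "mat_trace (1\<^sub>m n) = of_nat n"
  by (simp add: mat_trace_def)

lemma mult_mat_entry:
  assumes "A \<in> carrier_mat n m" "B \<in> carrier_mat m k" "i < n" "j < k"
  shows "(A * B) $$ (i, j) = (\<Sum>l<m. A $$ (i, l) * B $$ (l, j))"
  using assms by (simp add: scalar_prod_def lessThan_atLeast0)

lemma mat_trace_mult_comm:
  assumes "A \<in> carrier_mat n m" "B \<in> carrier_mat m n"
  shows "mat_trace (A * B) = mat_trace (B * A)"
proof -
  have "mat_trace (A * B) = (\<Sum>i<n. \<Sum>l<m. A $$ (i, l) * B $$ (l, i))"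
    using assms mult_mat_entry[OF assms] by (simp add: mat_trace_def)
  also have "\<dots> = (\<Sum>l<m. \<Sum>i<n. B $$ (l, i) * A $$ (i, l))"
    by (subst sum.swap) (simp add: mult.commute)
  also have "\<dots> = mat_trace (B * A)"
    using assms mult_mat_entry[OF assms(2,1)] by (simp add: mat_trace_def)
  finally show ?thesis .
qed

lemma mat_trace_similar:
  assumes "similar_mat A B"
  shows "mat_trace A = mat_trace B"
proof -
  obtain n P Q where carr: "{A, B, P, Q} \<subseteq> carrier_mat n n"
    and QP: "Q * P = 1\<^sub>m n" and A: "A = P * B * Q"
    using similar_matD[OF assms] by blast
  have "mat_trace A = mat_trace (P * (B * Q))"
    using carr A by (simp add: assoc_mult_mat[of P n n B n Q n])
  also have "\<dots> = mat_trace (B * Q * P)"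
    using carr by (intro mat_trace_mult_comm[of _ n n]) auto
  also have "B * Q * P = B"
    using carr QP by (simp add: assoc_mult_mat[of B n n Q n P n] right_mult_one_mat[of B n n])
  finally show ?thesis .
qed

section \<open>Diagonals of products and powers of upper triangular matrices\<close>

lemma upper_triangular_mult:
  fixes A B :: "'a :: comm_ring_1 mat"
  assumes A: "A \<in> carrier_mat n n" and B: "B \<in> carrier_mat n n"
    and tri: "upper_triangular A" "upper_triangular B"
  shows "upper_triangular (A * B)"
    and "i < n \<Longrightarrow> (A * B) $$ (i, i) = A $$ (i, i) * B $$ (i, i)"
proof -
  have low: "A $$ (i, l) = 0" "B $$ (i, l) = 0" if "l < i" "i < n" for i l
    using that tri A B by auto
  show "upper_triangular (A * B)"
  proof
    fix i j assume ij: "j < i" "i < dim_row (A * B)"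
    \<comment> \<open>Either \<open>l < i\<close>, and the left factor lies below the diagonal, or
      \<open>j < i\<close> and \<open>i\<close> is at most \<open>l\<close>, and the right factor
      does.\<close>
    have "A $$ (i, l) * B $$ (l, j) = 0" if "l < n" for l
      using low[of l i] low[of j l] ij A that by (cases "l < i") auto
    then show "(A * B) $$ (i, j) = 0"
      using ij A by (subst mult_mat_entry[OF A B]) auto
  qed
  show "(A * B) $$ (i, i) = A $$ (i, i) * B $$ (i, i)" if i: "i < n"
  proof -
    have "A $$ (i, l) * B $$ (l, i) = (if l = i then A $$ (i, i) * B $$ (i, i) else 0)"
      if "l < n" for l
      using low[of l i] low[of i l] i that by (cases "l < i"; cases "l = i") auto
    then have "(\<Sum>l<n. A $$ (i, l) * B $$ (l, i))
        = (\<Sum>l<n. if l = i then A $$ (i, i) * B $$ (i, i) else 0)"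
      by (intro sum.cong refl) blast
    also have "\<dots> = A $$ (i, i) * B $$ (i, i)"
      using i by simp
    finally show ?thesis
      by (simp only: mult_mat_entry[OF A B i i])
  qed
qed

lemma upper_triangular_pow:
  fixes A :: "'a :: comm_ring_1 mat"
  assumes A: "A \<in> carrier_mat n n" and tri: "upper_triangular A"
  shows "upper_triangular (A ^\<^sub>m k) \<and> (\<forall>i<n. (A ^\<^sub>m k) $$ (i, i) = (A $$ (i, i)) ^ k)"
proof (induction k)
  case 0
  show ?case using A by auto
next
  case (Suc k)
  have "A ^\<^sub>m k \<in> carrier_mat n n" using A by simp
  from upper_triangular_mult[OF this A] Suc tri show ?case by (simp add: mult.commute)
qed

text \<open>Schur triangularization makes \<open>A\<close> similar to an upper triangular
  \<open>B\<close> with diagonal \<open>as\<close>. Taking powers preserves similarity and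
  triangularity and raises the diagonal entrywise. As the splitting is a hypothesis, this applies
  over the reals as well.\<close>

lemma mat_trace_pow:
  fixes A :: "'a :: conjugatable_ordered_field mat"
  assumes A: "A \<in> carrier_mat n n" and cp: "char_poly A = (\<Prod>a\<leftarrow>as. [:- a, 1:])"
  shows "mat_trace (A ^\<^sub>m k) = (\<Sum>a\<leftarrow>as. a ^ k)"
proof -
  obtain B P Q where "schur_decomposition A as = (B, P, Q)"
    by (cases "schur_decomposition A as")
  from schur_decomposition[OF A cp this]
  have sim: "similar_mat_wit A B P Q" and tri: "upper_triangular B" and diag: "diag_mat B = as"
    by auto
  have B: "B \<in> carrier_mat n n"
    using similar_mat_witD2[OF A sim] by simp
  have "mat_trace (A ^\<^sub>m k) = mat_trace (B ^\<^sub>m k)"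
    using similar_mat_wit_pow[OF sim, of k] by (intro mat_trace_similar) (auto simp: similar_mat_def)
  also have "\<dots> = (\<Sum>i<n. (B $$ (i, i)) ^ k)"
    using B upper_triangular_pow[OF B tri, of k] by (simp add: mat_trace_def)
  also have "\<dots> = (\<Sum>a\<leftarrow>diag_mat B. a ^ k)"
    using B by (simp add: diag_mat_def comp_def interv_sum_list_conv_sum_set_nat lessThan_atLeast0)
  finally show ?thesis by (simp add: diag)
qed

section \<open>Reality of the spectrum of real symmetric matrices\<close>

lemma real_eigenvalue_of_symmetric:
  fixes A :: "real mat"
  assumes A: "A \<in> carrier_mat n n" and sym: "transpose_mat A = A"
    and ev: "eigenvalue (map_mat complex_of_real A) a"
  shows "a \<in> \<real>"
proof -
  let ?A = "map_mat complex_of_real A"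
  obtain v where v: "v \<in> carrier_vec n" "v \<noteq> 0\<^sub>v n" "?A *\<^sub>v v = a \<cdot>\<^sub>v v"
    using ev A unfolding eigenvalue_def eigenvector_def by auto
  have Av: "(\<Sum>j<n. A $$ (i, j) * v $ j) = a * v $ i" if "i < n" for i
  proof -
    have "(?A *\<^sub>v v) $ i = (\<Sum>j<n. A $$ (i, j) * v $ j)"
      using that A v(1) by (simp add: scalar_prod_def lessThan_atLeast0)
    then show ?thesis using v that by simp
  qed
  have symE: "A $$ (i, j) = A $$ (j, i)" if "i < n" "j < n" for i j
    using that A sym index_transpose_mat(1)[of i A j] by simp
  \<comment> \<open>\<open>q\<close> is the Hermitian form of \<open>A\<close> at \<open>v\<close>.
    The eigenvalue equation gives \<open>q = a * N\<close>; since \<open>A\<close> is real and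
    symmetric, \<open>cnj q = q\<close>. As \<open>N\<close> is a nonzero real, \<open>a\<close> is
    its own conjugate.\<close>
  define N where "N = (\<Sum>i<n. (cmod (v $ i))\<^sup>2)"
  define q where "q = (\<Sum>i<n. cnj (v $ i) * (\<Sum>j<n. A $$ (i, j) * v $ j))"
  have "cnj (v $ i) * (a * v $ i) = a * (cmod (v $ i))\<^sup>2" for i
    by (simp only: complex_norm_square mult_ac)
  then have "q = (\<Sum>i<n. a * (cmod (v $ i))\<^sup>2)"
    unfolding q_def by (intro sum.cong refl) (simp only: lessThan_iff Av)
  then have q: "q = a * N"
    by (simp add: N_def sum_distrib_left)
  have "cnj q = (\<Sum>i<n. \<Sum>j<n. v $ i * (A $$ (i, j) * cnj (v $ j)))"
    by (simp add: q_def sum_distrib_left)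
  also have "\<dots> = (\<Sum>j<n. \<Sum>i<n. v $ i * (A $$ (i, j) * cnj (v $ j)))"
    by (rule sum.swap)
  also have "\<dots> = q"
    unfolding q_def sum_distrib_left by (intro sum.cong refl) (simp add: symE)
  finally have "cnj q = q" .
  moreover have "N \<noteq> 0"
  proof
    assume "N = 0"
    then have "v $ i = 0" if "i < n" for i
      using that by (simp add: N_def sum_nonneg_eq_0_iff)
    then show False using v(1,2) by (auto intro: eq_vecI)
  qed
  ultimately have "cnj a = a" by (simp add: q)
  then show ?thesis by (simp add: Reals_cnj_iff)
qed

text \<open>The polynomial splits over the complex numbers, its roots there are real, and the
  embedding of real into complex polynomials is injective, so the factorization descends to the real
  parts.\<close>

lemma char_poly_symmetric_splits:
  fixes A :: "real mat"
  assumes A: "A \<in> carrier_mat n n" and sym: "transpose_mat A = A"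
  obtains as where "char_poly A = (\<Prod>a\<leftarrow>as. [:- a, 1:])" "length as = n"
proof -
  let ?A = "map_mat complex_of_real A"
  interpret h: map_poly_inj_comm_ring_hom complex_of_real ..
  have A': "?A \<in> carrier_mat n n" using A by simp
  obtain cs where cs: "char_poly ?A = (\<Prod>c\<leftarrow>cs. [:- c, 1:])" "length cs = n"
    using char_poly_factorized[OF A'] by blast
  have "c \<in> \<real>" if "c \<in> set cs" for c
    using linear_poly_root[OF that] cs(1)
    by (intro real_eigenvalue_of_symmetric[OF A sym]) (simp add: eigenvalue_root_char_poly[OF A'])
  then have re: "map complex_of_real (map Re cs) = cs"
    by (simp add: map_idI)
  have "map_poly complex_of_real (\<Prod>a\<leftarrow>map Re cs. [:- a, 1:])
      = (\<Prod>c\<leftarrow>map complex_of_real (map Re cs). [:- c, 1:])"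
    by (simp add: h.hom_prod_list comp_def)
  also have "\<dots> = map_poly complex_of_real (char_poly A)"
    by (simp only: re of_real_hom.char_poly_hom[OF A] flip: cs(1))
  finally have "char_poly A = (\<Prod>a\<leftarrow>map Re cs. [:- a, 1:])"
    by simp
  with cs(2) show ?thesis using that[of "map Re cs"] by simp
qed

lemma proots_prod_linear_factors:
  fixes as :: "'a :: idom list"
  shows "proots (\<Prod>a\<leftarrow>as. [:- a, 1:]) = mset as"
proof (induction as)
  case (Cons a as)
  have "(\<Prod>a\<leftarrow>as. [:- a, 1:]) \<noteq> 0" by (auto simp: prod_list_zero_iff)
  with Cons show ?case by (simp add: proots_mult del: mult_pCons_left)
qed simp

text \<open>All information drawn from a spectrum passes through here: the size gives the dimension,
  and later only the exponents 1, 2, 4 and 6 occur.\<close>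

lemma symmetric_power_traces:
  fixes A :: "real mat"
  assumes A: "A \<in> carrier_mat n n" and sym: "transpose_mat A = A"
  shows "size (proots (char_poly A)) = n"
    and "mat_trace (A ^\<^sub>m k) = (\<Sum>x\<in>#proots (char_poly A). x ^ k)"
proof -
  obtain as where as: "char_poly A = (\<Prod>a\<leftarrow>as. [:- a, 1:])" "length as = n"
    using char_poly_symmetric_splits[OF A sym] .
  have "proots (char_poly A) = mset as"
    by (simp add: as proots_prod_linear_factors)
  then show "size (proots (char_poly A)) = n"
    and "mat_trace (A ^\<^sub>m k) = (\<Sum>x\<in>#proots (char_poly A). x ^ k)"
    using as mat_trace_pow[OF A as(1)] by (simp_all flip: sum_mset_sum_list mset_map)
qed

section \<open>Traces of squares as a test for vanishing\<close>

lemma mat_trace_diff_square: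
  assumes X: "X \<in> carrier_mat n n" and Y: "Y \<in> carrier_mat n n"
  shows "mat_trace ((X - Y) * (X - Y)) = mat_trace (X * X) - 2 * mat_trace (X * Y) + mat_trace (Y * Y)"
proof -
  have XY: "X - Y \<in> carrier_mat n n" using Y by (rule minus_carrier_mat)
  have "(X - Y) * (X - Y) = (X * X - X * Y) - (Y * X - Y * Y)"
    by (simp only: minus_mult_distrib_mat[OF X Y XY] mult_minus_distrib_mat[OF X X Y]
        mult_minus_distrib_mat[OF Y X Y])
  then have "mat_trace ((X - Y) * (X - Y))
      = (mat_trace (X * X) - mat_trace (X * Y)) - (mat_trace (Y * X) - mat_trace (Y * Y))"
    using X Y by (simp add: mat_trace_minus[of _ n] minus_carrier_mat)
  then show ?thesis
    by (simp add: mat_trace_mult_comm[OF Y X])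
qed

text \<open>By symmetry the trace of \<open>C * C\<close> is the sum of the squares of all entries
  of \<open>C\<close>.\<close>

lemma symmetric_mat_eq_0:
  fixes C :: "real mat"
  assumes C: "C \<in> carrier_mat n n" and sym: "transpose_mat C = C" and 0: "mat_trace (C * C) = 0"
  shows "C = 0\<^sub>m n n"
proof -
  have sq: "C $$ (i, j) * C $$ (j, i) = (C $$ (i, j))\<^sup>2" if "i < n" "j < n" for i j
    using that C sym index_transpose_mat(1)[of i C j] by (simp add: power2_eq_square)
  have "mat_trace (C * C) = (\<Sum>i<n. \<Sum>j<n. (C $$ (i, j))\<^sup>2)"
    using C by (simp add: mat_trace_def mult_mat_entry[OF C C] sq del: index_mult_mat(1))
  then have "(\<Sum>i<n. \<Sum>j<n. (C $$ (i, j))\<^sup>2) = 0"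
    using 0 by simp
  then have "C $$ (i, j) = 0" if "i < n" "j < n" for i j
    using that by (simp add: sum_nonneg_eq_0_iff sum_nonneg)
  then show ?thesis using C by (auto intro: eq_matI)
qed

subsection \<open>The vector of signs of the new vertex\<close>

text \<open>With \<open>b\<close> the \<open>j\<close>-th column of \<open>R\<close>, the sum of the squared entries of \<open>R - b b\<^sup>T\<close> is \<open>c\<^sup>2 - 2 c\<^sup>2 + c\<^sup>2\<close>.\<close>

lemma rank_one_of_trace:
  fixes R :: "'i \<Rightarrow> 'i \<Rightarrow> real"
  assumes fin: "finite I"
    and sym: "\<And>i k. i \<in> I \<Longrightarrow> k \<in> I \<Longrightarrow> R i k = R k i"
    and idem: "\<And>i k. i \<in> I \<Longrightarrow> k \<in> I \<Longrightarrow> (\<Sum>l\<in>I. R i l * R l k) = c * R i k"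
    and tr: "(\<Sum>i\<in>I. R i i) = c"
    and j: "j \<in> I" "R j j = 1"
    and ik: "i \<in> I" "k \<in> I"
  shows "R i k = R i j * R k j"
proof -
  have sq: "(\<Sum>l\<in>I. (R i l)\<^sup>2) = c * R i i" if "i \<in> I" for i
  proof -
    have "(\<Sum>l\<in>I. (R i l)\<^sup>2) = (\<Sum>l\<in>I. R i l * R l i)"
      using that by (intro sum.cong refl) (simp add: power2_eq_square sym)
    then show ?thesis using idem that by simp
  qed
  \<comment> \<open>The normalization \<open>R j j = 1\<close> enters here: the squared norm of
    column \<open>j\<close> is \<open>c * R j j\<close>.\<close>
  have norm: "(\<Sum>i\<in>I. (R i j)\<^sup>2) = c"
    using sq[OF j(1)] j sym by (simp cong: sum.cong)
  have "(\<Sum>i\<in>I. \<Sum>l\<in>I. (R i l - R i j * R l j)\<^sup>2)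
      = (\<Sum>i\<in>I. c * R i i - 2 * c * (R i j)\<^sup>2 + c * (R i j)\<^sup>2)"
  proof (rule sum.cong[OF refl])
    fix i assume i: "i \<in> I"
    have "(\<Sum>l\<in>I. (R i l - R i j * R l j)\<^sup>2)
        = (\<Sum>l\<in>I. (R i l)\<^sup>2 - 2 * R i j * (R i l * R l j) + (R i j)\<^sup>2 * (R l j)\<^sup>2)"
      by (intro sum.cong refl) (simp add: power2_diff power_mult_distrib)
    also have "\<dots> = (\<Sum>l\<in>I. (R i l)\<^sup>2) - 2 * R i j * (\<Sum>l\<in>I. R i l * R l j)
        + (R i j)\<^sup>2 * (\<Sum>l\<in>I. (R l j)\<^sup>2)"
      by (simp add: sum.distrib sum_subtractf sum_distrib_left)
    also have "\<dots> = c * R i i - 2 * c * (R i j)\<^sup>2 + c * (R i j)\<^sup>2"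
      using i j by (simp add: sq[OF i] idem norm) (simp add: power2_eq_square)
    finally show "(\<Sum>l\<in>I. (R i l - R i j * R l j)\<^sup>2)
        = c * R i i - 2 * c * (R i j)\<^sup>2 + c * (R i j)\<^sup>2" .
  qed
  also have "\<dots> = c * (\<Sum>i\<in>I. R i i) - c * (\<Sum>i\<in>I. (R i j)\<^sup>2)"
    by (simp add: sum_subtractf sum_distrib_left)
  also have "\<dots> = 0" by (simp add: tr norm)
  finally have "(\<Sum>i\<in>I. \<Sum>l\<in>I. (R i l - R i j * R l j)\<^sup>2) = 0" .
  then have "(R i k - R i j * R k j)\<^sup>2 = 0"
    using ik fin by (simp add: sum_nonneg_eq_0_iff sum_nonneg)
  then show ?thesis by simp
qed

text \<open>\<open>tr ((A R)\<^sup>2)\<close> is the sum of \<open>x\<^sup>2 (\<lambda>\<^sup>2 - x\<^sup>2)\<^sup>2\<close> over the spectrum, which is \<open>0\<close>.\<close>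

lemma complement_of_square:
  fixes A :: "real mat" and lam :: real
  assumes A: "A \<in> carrier_mat n n" and sym: "transpose_mat A = A"
    and spec: "proots (char_poly A) = replicate_mset m (- lam) + replicate_mset 1 0 + replicate_mset m lam"
  defines "R \<equiv> lam\<^sup>2 \<cdot>\<^sub>m 1\<^sub>m n - A * A"
  shows "A * R = 0\<^sub>m n n" and "R * R = lam\<^sup>2 \<cdot>\<^sub>m R" and "mat_trace R = lam\<^sup>2"
proof -
  note tr = symmetric_power_traces(2)[OF A sym, unfolded spec]
  have n: "n = 2 * m + 1"
    using symmetric_power_traces(1)[OF A sym] by (simp add: spec)
  have AA: "A * A \<in> carrier_mat n n" using A by simp
  have A3: "A * (A * A) \<in> carrier_mat n n" using A by simp
  have one: "lam\<^sup>2 \<cdot>\<^sub>m 1\<^sub>m n \<in> carrier_mat n n" by simp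
  have R: "R \<in> carrier_mat n n" using AA unfolding R_def by (rule minus_carrier_mat)
  \<comment> \<open>The bracketings are those that arise when the square of \<open>A * R\<close>,
    the difference of \<open>lam^2\<close> times \<open>A\<close> and the cube of \<open>A\<close>,
    is expanded.\<close>
  have pow: "A ^\<^sub>m 2 = A * A" "A ^\<^sub>m 4 = A * (A * (A * A))"
    "A ^\<^sub>m 6 = A * (A * A) * (A * (A * A))"
    using A by (simp_all add: eval_nat_numeral assoc_mult_mat[of _ n n _ n _ n])
  have tr2: "mat_trace (A * A) = 2 * m * lam\<^sup>2"
    and tr4: "mat_trace (A * (A * (A * A))) = 2 * m * lam ^ 4"
    and tr6: "mat_trace (A * (A * A) * (A * (A * A))) = 2 * m * lam ^ 6"
    using tr[of 2] tr[of 4] tr[of 6] unfolding pow by simp_all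
  have "mat_trace R = lam\<^sup>2 * n - 2 * m * lam\<^sup>2"
    using A unfolding R_def by (simp add: mat_trace_minus[OF one AA] mat_trace_smult[of _ n] mat_trace_one tr2)
  then show "mat_trace R = lam\<^sup>2" by (simp add: n algebra_simps)
  have AR: "A * R = lam\<^sup>2 \<cdot>\<^sub>m A - A * (A * A)"
    unfolding R_def mult_minus_distrib_mat[OF A one AA]
    using A by (simp add: mult_smult_distrib[OF A, of _ n])
  let ?X = "lam\<^sup>2 \<cdot>\<^sub>m A"
  have X: "?X \<in> carrier_mat n n" using A by simp
  have "mat_trace (A * R * (A * R)) = lam\<^sup>2 * lam\<^sup>2 * mat_trace (A * A)
      - 2 * (lam\<^sup>2 * mat_trace (A * (A * (A * A)))) + mat_trace (A * (A * A) * (A * (A * A)))"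
    unfolding AR mat_trace_diff_square[OF X A3]
    using A by (simp add: mult_smult_assoc_mat[of _ n n _ n] mult_smult_distrib[of _ n n _ n]
        mat_trace_smult[of _ n])
  also have "\<dots> = 0"
    by (simp add: tr2 tr4 tr6 eval_nat_numeral algebra_simps)
  finally have 0: "mat_trace (A * R * (A * R)) = 0" .
  \<comment> \<open>\<open>A * R\<close> is a polynomial in the symmetric \<open>A\<close>, hence
    symmetric, so the vanishing trace of its square forces it to be zero.\<close>
  have "transpose_mat (lam\<^sup>2 \<cdot>\<^sub>m A) = lam\<^sup>2 \<cdot>\<^sub>m transpose_mat A"
    by (rule eq_matI) auto
  then have "transpose_mat (A * R) = A * R"
    unfolding AR using A sym
    by (simp add: transpose_minus[of _ n n] transpose_mult[of _ n n _ n]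
        assoc_mult_mat[of _ n n _ n _ n])
  with 0 show AR0: "A * R = 0\<^sub>m n n"
    using A R by (intro symmetric_mat_eq_0) auto
  have "R * R = (lam\<^sup>2 \<cdot>\<^sub>m 1\<^sub>m n) * R - A * A * R"
    using minus_mult_distrib_mat[OF one AA R] by (simp only: R_def)
  also have "\<dots> = lam\<^sup>2 \<cdot>\<^sub>m R - A * (A * R)"
    using A R by (simp add: mult_smult_assoc_mat[of _ n n _ n] assoc_mult_mat[of _ n n _ n _ n])
  also have "\<dots> = lam\<^sup>2 \<cdot>\<^sub>m R"
    using A R by (auto simp: AR0)
  finally show "R * R = lam\<^sup>2 \<cdot>\<^sub>m R" .
qed

text \<open>\<open>b\<close> is a column of the rank one matrix \<open>R\<close> at an index where
  the diagonal is nonzero, hence 1 by \<open>diag\<close>. Then \<open>b $ i\<close> squares to a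
  diagonal entry of \<open>R\<close>, which is 0 or 1; \<open>A * R = 0\<close> puts
  \<open>b\<close> in the kernel, and its squared norm is the trace of \<open>R\<close>.\<close>

lemma extension_vector:
  fixes A :: "real mat" and lam :: real
  assumes A: "A \<in> carrier_mat n n" and sym: "transpose_mat A = A"
    and spec: "proots (char_poly A) = replicate_mset m (- lam) + replicate_mset 1 0 + replicate_mset m lam"
    and diag: "\<And>i. i < n \<Longrightarrow> (A * A) $$ (i, i) = lam\<^sup>2 \<or> (A * A) $$ (i, i) = lam\<^sup>2 - 1"
  obtains b where "b \<in> carrier_vec n" "\<And>i. i < n \<Longrightarrow> b $ i \<in> {0, 1, -1}"
    "\<And>i k. i < n \<Longrightarrow> k < n \<Longrightarrow>
      (A * A) $$ (i, k) + b $ i * b $ k = (if i = k then lam\<^sup>2 else 0)"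
    "A *\<^sub>v b = 0\<^sub>v n" "b \<bullet> b = lam\<^sup>2"
proof -
  define R where "R = lam\<^sup>2 \<cdot>\<^sub>m 1\<^sub>m n - A * A"
  have AA: "A * A \<in> carrier_mat n n" using A by simp
  have R: "R \<in> carrier_mat n n"
    using AA unfolding R_def by (rule minus_carrier_mat)
  have Rij: "R $$ (i, k) = (if i = k then lam\<^sup>2 else 0) - (A * A) $$ (i, k)" if "i < n" "k < n" for i k
    using that A by (simp add: R_def)
  note R_props = complement_of_square[OF A sym spec, folded R_def]
  have tr: "(\<Sum>i<n. R $$ (i, i)) = lam\<^sup>2"
    using R_props(3) R by (simp add: mat_trace_def)
  have "transpose_mat (A * A) = A * A"
    using A sym by (simp add: transpose_mult[of _ n n _ n])
  then have symR: "R $$ (i, k) = R $$ (k, i)" if "i < n" "k < n" for i k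
    using that A index_transpose_mat(1)[of i "A * A" k] by (simp add: Rij del: index_mult_mat(1))
  show thesis
  proof (cases "\<exists>j<n. R $$ (j, j) \<noteq> 0")
    \<comment> \<open>A zero diagonal makes the trace \<open>lam^2\<close> zero, so
      \<open>R * R\<close> and with it \<open>R\<close> vanish; \<open>b\<close> is the zero vector
      and the new vertex will be isolated.\<close>
    case False
    then have "lam\<^sup>2 = 0" using tr by simp
    moreover have "R = 0\<^sub>m n n"
    proof (rule symmetric_mat_eq_0[OF R])
      show "transpose_mat R = R" using R symR by (intro eq_matI) auto
      show "mat_trace (R * R) = 0"
        using \<open>lam\<^sup>2 = 0\<close> R by (simp add: R_props(2) mat_trace_smult)
    qed
    ultimately have "(A * A) $$ (i, k) = 0" if "i < n" "k < n" for i k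
      using Rij[OF that] that by (simp split: if_splits)
    then show thesis
      using A \<open>lam\<^sup>2 = 0\<close> by (intro that[of "0\<^sub>v n"]) (auto simp del: index_mult_mat(1))
  next
    case True
    then obtain j where j: "j < n" "R $$ (j, j) \<noteq> 0" by blast
    with diag[of j] have j1: "R $$ (j, j) = 1" by (auto simp: Rij)
    have R1: "R $$ (i, k) = R $$ (i, j) * R $$ (k, j)" if "i < n" "k < n" for i k
    proof (rule rank_one_of_trace[where I = "{..<n}" and c = "lam\<^sup>2"])
      show "(\<Sum>l<n. R $$ (i, l) * R $$ (l, k)) = lam\<^sup>2 * R $$ (i, k)"
        if "i \<in> {..<n}" "k \<in> {..<n}" for i k
        using that R mult_mat_entry[OF R R, of i k] by (simp add: R_props(2))
    qed (use that j j1 tr symR in auto)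
    show thesis
    proof (rule that[of "col R j"])
      show "col R j \<in> carrier_vec n" using R by (rule col_carrier_vec[OF j(1)])
      show "col R j $ i \<in> {0, 1, -1}" if "i < n" for i
      proof -
        have "(R $$ (i, j))\<^sup>2 = R $$ (i, i)"
          using R1[OF that that] by (simp add: power2_eq_square)
        also have "\<dots> \<in> {0, 1}" using diag[OF that] that by (auto simp: Rij)
        finally show ?thesis using that j R by (auto simp: power2_eq_1_iff)
      qed
      show "(A * A) $$ (i, k) + col R j $ i * col R j $ k = (if i = k then lam\<^sup>2 else 0)"
        if "i < n" "k < n" for i k
        using Rij[OF that] R1[OF that] that j R by simp
      show "A *\<^sub>v col R j = 0\<^sub>v n"
        unfolding col_mult2[OF A R j(1), symmetric] R_props(1) using j(1) by (intro eq_vecI) simp_all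
      have "col R j \<bullet> col R j = (\<Sum>i<n. R $$ (i, j) * R $$ (i, j))"
        using R j(1) by (simp add: scalar_prod_def lessThan_atLeast0)
      also have "\<dots> = (\<Sum>i<n. R $$ (i, i))"
        by (intro sum.cong refl R1[symmetric]) simp_all
      finally show "col R j \<bullet> col R j = lam\<^sup>2" by (simp add: tr)
    qed
  qed
qed

subsection \<open>The spectrum of the bordered matrix\<close>

text \<open>With \<open>p\<close> copies of \<open>l\<close> and \<open>q\<close> of
  \<open>- l\<close>, the zero sum gives \<open>p = q\<close> when \<open>l\<close> is nonzero, and
  the size then gives \<open>k\<close>. For \<open>l = 0\<close> both values coincide and the size
  alone decides.\<close>

lemma multiset_plus_minus:
  fixes l :: real
  assumes pm: "\<And>x. x \<in># M \<Longrightarrow> x = l \<or> x = - l"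
    and sum: "\<Sum>\<^sub># M = 0" and size: "size M = 2 * k"
  shows "M = replicate_mset k (- l) + replicate_mset k l"
proof (cases "l = 0")
  case True
  then have "set_mset M \<subseteq> {0}" using pm by auto
  then obtain j where "M = replicate_mset j 0"
    by (metis set_mset_subset_singletonD)
  with size True show ?thesis
    by (simp add: mult_2 multiset_eq_iff)
next
  case False
  define p where "p = count M l"
  have "set_mset (filter_mset (\<lambda>x. x \<noteq> l) M) \<subseteq> {- l}" using pm by auto
  then obtain q where "filter_mset (\<lambda>x. x \<noteq> l) M = replicate_mset q (- l)"
    by (metis set_mset_subset_singletonD)
  moreover have "filter_mset (\<lambda>x. x = l) M = replicate_mset p l"
    by (simp add: p_def filter_eq_replicate_mset)
  ultimately have M: "M = replicate_mset p l + replicate_mset q (- l)"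
    using multiset_partition[of M "\<lambda>x. x = l"] by simp
  have "real p * l - real q * l = 0" using sum by (simp add: M)
  then have "p = q" using False by (simp add: left_diff_distrib[symmetric])
  with size have "q = k" by (simp add: M)
  then show ?thesis by (simp add: M \<open>p = q\<close> add.commute)
qed

text \<open>Applying \<open>B\<close> twice to an eigenvector shows that each eigenvalue is
  \<open>c\<close> or \<open>- c\<close>; the trace, being their sum, balances the
  multiplicities.\<close>

lemma spectrum_of_scalar_square:
  fixes B :: "real mat"
  assumes B: "B \<in> carrier_mat n n" and sym: "transpose_mat B = B"
    and sq: "B * B = c\<^sup>2 \<cdot>\<^sub>m 1\<^sub>m n" and tr: "mat_trace B = 0" and n: "n = 2 * k"
  shows "proots (char_poly B) = replicate_mset k (- c) + replicate_mset k c"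
proof (rule multiset_plus_minus)
  fix x assume "x \<in># proots (char_poly B)"
  then have "poly (char_poly B) x = 0" by (cases "char_poly B = 0") auto
  then have "eigenvalue B x" by (simp add: eigenvalue_root_char_poly[OF B])
  then obtain v where v: "v \<in> carrier_vec n" "v \<noteq> 0\<^sub>v n" "B *\<^sub>v v = x \<cdot>\<^sub>v v"
    using B unfolding eigenvalue_def eigenvector_def by auto
  have "c\<^sup>2 \<cdot>\<^sub>v v = (B * B) *\<^sub>v v"
    using v(1) by (intro eq_vecI) (simp_all add: sq)
  also have "\<dots> = B *\<^sub>v (B *\<^sub>v v)" using B v by (simp add: assoc_mult_mat_vec[of _ n n _ n])
  also have "\<dots> = x\<^sup>2 \<cdot>\<^sub>v v"
    using B v by (simp add: mult_mat_vec smult_smult_assoc power2_eq_square)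
  finally have eq: "c\<^sup>2 \<cdot>\<^sub>v v = x\<^sup>2 \<cdot>\<^sub>v v" .
  obtain i where i: "i < n" "v $ i \<noteq> 0"
    using v(1,2) by (metis carrier_vecD eq_vecI index_zero_vec)
  have "c\<^sup>2 * v $ i = x\<^sup>2 * v $ i"
    using arg_cong[OF eq, of "\<lambda>w. w $ i"] i v(1) by simp
  then have "x\<^sup>2 = c\<^sup>2" using i by simp
  then show "x = c \<or> x = - c" by (simp add: power2_eq_iff)
next
  show "\<Sum>\<^sub># (proots (char_poly B)) = 0"
    using symmetric_power_traces(2)[OF B sym, of 1] tr B by simp
  show "size (proots (char_poly B)) = 2 * k"
    using symmetric_power_traces(1)[OF B sym] n by simp
qed

text \<open>The border takes index 0 and old indices are shifted by \<open>Suc\<close>, which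
  matches the vertex order \<open>None # map Some vs\<close>.\<close>

definition bordered_mat :: "'a :: zero vec \<Rightarrow> 'a mat \<Rightarrow> 'a mat" where
  "bordered_mat b A = mat (Suc (dim_row A)) (Suc (dim_col A)) (\<lambda>(i, j).
     case (i, j) of (0, 0) \<Rightarrow> 0 | (0, Suc j) \<Rightarrow> b $ j | (Suc i, 0) \<Rightarrow> b $ i | (Suc i, Suc j) \<Rightarrow> A $$ (i, j))"

text \<open>The square of the bordered matrix has the corner \<open>b \<bullet> b\<close>, the
  off-diagonal blocks \<open>A *\<^sub>v b\<close> and its transpose, and the block of
  \<open>A * A\<close> plus the outer square of \<open>b\<close>; the hypotheses evaluate each of
  them.\<close>

lemma bordered_mat_spectrum:
  fixes A :: "real mat" and lam :: real
  assumes A: "A \<in> carrier_mat n n" and sym: "transpose_mat A = A"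
    and b: "b \<in> carrier_vec n"
    and sq: "\<And>i k. i < n \<Longrightarrow> k < n \<Longrightarrow>
      (A * A) $$ (i, k) + b $ i * b $ k = (if i = k then lam\<^sup>2 else 0)"
    and Ab: "A *\<^sub>v b = 0\<^sub>v n" and bb: "b \<bullet> b = lam\<^sup>2"
    and tr: "mat_trace A = 0" and n: "Suc n = 2 * k"
  shows "proots (char_poly (bordered_mat b A)) = replicate_mset k (- lam) + replicate_mset k lam"
proof (rule spectrum_of_scalar_square)
  let ?B = "bordered_mat b A"
  show B: "?B \<in> carrier_mat (Suc n) (Suc n)" using A by (simp add: bordered_mat_def)
  have ent: "?B $$ (0, 0) = 0" "j < n \<Longrightarrow> ?B $$ (0, Suc j) = b $ j" "i < n \<Longrightarrow> ?B $$ (Suc i, 0) = b $ i"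
    "i < n \<Longrightarrow> j < n \<Longrightarrow> ?B $$ (Suc i, Suc j) = A $$ (i, j)" for i j
    using A by (simp_all add: bordered_mat_def)
  have symA: "A $$ (i, j) = A $$ (j, i)" if "i < n" "j < n" for i j
    using that A sym index_transpose_mat(1)[of i A j] by simp
  have Ab0: "(\<Sum>l<n. A $$ (i, l) * b $ l) = 0" if "i < n" for i
    using arg_cong[OF Ab, of "\<lambda>v. v $ i"] that A b by (simp add: scalar_prod_def lessThan_atLeast0)
  have bA0: "(\<Sum>l<n. b $ l * A $$ (l, i)) = 0" if "i < n" for i
    using Ab0[OF that] that by (simp add: symA mult.commute cong: sum.cong_simp)
  have bb': "(\<Sum>l<n. b $ l * b $ l) = lam\<^sup>2"
    using bb b by (simp add: scalar_prod_def lessThan_atLeast0)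
  show "transpose_mat ?B = ?B"
  proof (rule eq_matI)
    fix i j assume "i < dim_row ?B" "j < dim_col ?B"
    then show "transpose_mat ?B $$ (i, j) = ?B $$ (i, j)"
      using B by (cases i; cases j) (auto simp: ent symA)
  qed (use B in auto)
  show "mat_trace ?B = 0"
    using tr carrier_matD(1)[OF B] A
    by (simp add: mat_trace_def sum.lessThan_Suc_shift ent del: sum.lessThan_Suc)
  show "?B * ?B = lam\<^sup>2 \<cdot>\<^sub>m 1\<^sub>m (Suc n)"
  proof (rule eq_matI)
    fix i j assume "i < dim_row (lam\<^sup>2 \<cdot>\<^sub>m 1\<^sub>m (Suc n) :: real mat)"
      "j < dim_col (lam\<^sup>2 \<cdot>\<^sub>m 1\<^sub>m (Suc n) :: real mat)"
    then have ij: "i < Suc n" "j < Suc n" by auto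
    \<comment> \<open>In the lower right block \<open>i - 1\<close> and \<open>j - 1\<close> undo
      the shift by \<open>Suc\<close>.\<close>
    show "(?B * ?B) $$ (i, j) = (lam\<^sup>2 \<cdot>\<^sub>m 1\<^sub>m (Suc n)) $$ (i, j)"
      unfolding mult_mat_entry[OF B B ij] sum.lessThan_Suc_shift
      using ij sq[of "i - 1" "j - 1"]
      by (cases i; cases j)
        (simp_all add: ent Ab0 bA0 bb' mult_mat_entry[OF A A] add.commute del: index_mult_mat(1))
  qed (use B in auto)
qed (rule n)

subsection \<open>Adjacency matrices and adding a vertex\<close>

lemma adj_matrix_carrier: "adj_matrix G vs \<in> carrier_mat (length vs) (length vs)"
  by (simp add: adj_matrix_def)

lemma adj_matrix_symmetric: "transpose_mat (adj_matrix G vs) = adj_matrix G vs"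
  by (rule eq_matI) (auto simp: adj_matrix_def insert_commute)

lemma adj_matrix_trace:
  assumes "is_signed_graph G"
  shows "mat_trace (adj_matrix G vs) = 0"
proof -
  \<comment> \<open>A diagonal entry is looked up at a singleton, whereas edges have two
    elements.\<close>
  have "{v} \<notin> edges G" for v
    using assms by (force simp: is_signed_graph_def)
  then show ?thesis by (simp add: mat_trace_def adj_matrix_def)
qed

text \<open>Signs square to 1, so the diagonal entry counts neighbours, and joining each neighbour
  to the fixed vertex gives a bijection onto the incident edges.\<close>

lemma adj_matrix_square_diag:
  assumes G: "is_signed_graph G" and vs: "distinct vs" "set vs = verts G" and i: "i < length vs"
  shows "(adj_matrix G vs * adj_matrix G vs) $$ (i, i) = real (vdegree G (vs ! i))"
proof -
  let ?n = "length vs" and ?A = "adj_matrix G vs"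
  let ?K = "{k. k < ?n \<and> {vs ! i, vs ! k} \<in> edges G}"
  have "?A $$ (i, k) * ?A $$ (k, i) = (if {vs ! i, vs ! k} \<in> edges G then 1 else 0)" if "k < ?n" for k
    using G i that by (auto simp: adj_matrix_def is_signed_graph_def insert_commute)
  then have "(?A * ?A) $$ (i, i) = (\<Sum>k<?n. if {vs ! i, vs ! k} \<in> edges G then 1 else 0)"
    by (simp add: mult_mat_entry[OF adj_matrix_carrier adj_matrix_carrier i i] del: index_mult_mat(1))
  also have "\<dots> = real (card ?K)"
    by (simp add: sum.If_cases Int_def lessThan_def)
  also have "card ?K = vdegree G (vs ! i)"
    unfolding vdegree_def
  proof (rule bij_betw_same_card[of "\<lambda>k. {vs ! i, vs ! k}"], unfold bij_betw_def, safe)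
    show "inj_on (\<lambda>k. {vs ! i, vs ! k}) ?K"
      using vs(1) by (auto simp: inj_on_def doubleton_eq_iff nth_eq_iff_index_eq)
    fix e assume e: "e \<in> edges G" "vs ! i \<in> e"
    then have "e \<subseteq> verts G" "card e = 2" using G by (auto simp: is_signed_graph_def)
    then obtain w where w: "e = {vs ! i, w}" "w \<in> verts G"
      using e(2) by (auto simp: card_2_iff)
    from w(2) have "w \<in> set vs" by (simp only: vs(2))
    then obtain k where k: "k < ?n" "vs ! k = w" unfolding in_set_conv_nth by auto
    have eq: "e = {vs ! i, vs ! k}" by (simp only: k(2) w(1))
    with e(1) k(1) have "k \<in> ?K" by simp
    with eq show "e \<in> (\<lambda>k. {vs ! i, vs ! k}) ` ?K" by (rule image_eqI)
  qed
  finally show ?thesis .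
qed

text \<open>\<open>None\<close> is a fresh vertex, and the value 0 of \<open>s\<close> encodes
  non-adjacency to it. As \<open>sign\<close> acts on sets, \<open>THE\<close> recovers the old
  endpoint of a new edge.\<close>

definition add_vertex :: "('a \<Rightarrow> int) \<Rightarrow> 'a signed_graph \<Rightarrow> 'a option signed_graph" where
  "add_vertex s G =
     \<lparr> verts = insert None (Some ` verts G),
       edges = (\<lambda>v. {None, Some v}) ` {v \<in> verts G. s v \<noteq> 0} \<union> (\<lambda>e. Some ` e) ` edges G,
       sign = (\<lambda>e. if None \<in> e then s (THE v. Some v \<in> e) else sign G (Some -` e)) \<rparr>"

lemma Some_image_simps: "Some -` (Some ` e) = e" "None \<notin> Some ` e"
  by (auto simp: inj_vimage_image_eq)

lemma is_signed_graph_add_vertex: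
  assumes G: "is_signed_graph G" and s: "\<And>v. v \<in> verts G \<Longrightarrow> s v \<in> {0, 1, -1}"
  shows "is_signed_graph (add_vertex s G)"
  unfolding is_signed_graph_def
proof (intro conjI ballI)
  show "finite (verts (add_vertex s G))"
    using G by (simp add: add_vertex_def is_signed_graph_def)
  fix e assume "e \<in> edges (add_vertex s G)"
  then consider v where "v \<in> verts G" "s v \<noteq> 0" "e = {None, Some v}"
    | f where "f \<in> edges G" "e = Some ` f"
    by (auto simp: add_vertex_def)
  then have "e \<subseteq> verts (add_vertex s G) \<and> card e = 2 \<and> sign (add_vertex s G) e \<in> {1, -1}"
  proof cases
    case (1 v)
    then show ?thesis using s[of v] by (auto simp: add_vertex_def)
  next
    case (2 f)
    then show ?thesis
      using G by (auto simp: add_vertex_def is_signed_graph_def card_image Some_image_simps)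
  qed
  then show "e \<subseteq> verts (add_vertex s G)" "card e = 2" "sign (add_vertex s G) e \<in> {1, -1}"
    by auto
qed

lemma adj_matrix_add_vertex:
  assumes vs: "set vs = verts G"
  shows "adj_matrix (add_vertex s G) (None # map Some vs)
    = bordered_mat (vec (length vs) (\<lambda>i. of_int (s (vs ! i)))) (adj_matrix G vs)"
proof (rule eq_matI)
  let ?n = "length vs"
  let ?H = "add_vertex s G"
  have new: "{None, Some v} \<in> edges ?H \<longleftrightarrow> v \<in> verts G \<and> s v \<noteq> 0" for v
  proof -
    have "{None, Some v} \<notin> (\<lambda>e. Some ` e) ` edges G"
      by (metis Some_image_simps(2) imageE insertI1)
    then show ?thesis by (auto simp: add_vertex_def doubleton_eq_iff)
  qed
  have new_sign: "sign ?H {None, Some v} = s v" for v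
    by (simp add: add_vertex_def)
  have old: "{Some u, Some v} \<in> edges ?H \<longleftrightarrow> {u, v} \<in> edges G"
    and old_sign: "sign ?H {Some u, Some v} = sign G {u, v}" for u v
  proof -
    have eq: "{Some u, Some v} = Some ` {u, v}" by simp
    have "Some ` {u, v} \<in> (\<lambda>e. Some ` e) ` edges G \<longleftrightarrow> {u, v} \<in> edges G"
      by (rule inj_image_mem_iff) (simp add: inj_image_eq_iff inj_def)
    then show "{Some u, Some v} \<in> edges ?H \<longleftrightarrow> {u, v} \<in> edges G"
      unfolding eq by (auto simp: add_vertex_def)
    show "sign ?H {Some u, Some v} = sign G {u, v}"
      unfolding eq by (simp add: add_vertex_def Some_image_simps del: image_insert)
  qed
  have "{None} \<noteq> {None, Some v}" "{None} \<noteq> Some ` e" for v and e :: "'a set"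
    by auto
  \<comment> \<open>The corner entry of the matrix is looked up at the set
    \<open>{None}\<close>.\<close>
  then have loop: "{None} \<notin> edges ?H"
    by (simp add: add_vertex_def image_iff)
  let ?B = "bordered_mat (vec ?n (\<lambda>i. of_int (s (vs ! i)))) (adj_matrix G vs) :: real mat"
  fix i j assume "i < dim_row ?B" "j < dim_col ?B"
  then have ij: "i < Suc ?n" "j < Suc ?n" by (simp_all add: bordered_mat_def adj_matrix_def)
  have mem: "vs ! k \<in> verts G" if "k < ?n" for k
    using that unfolding vs[symmetric] by (rule nth_mem)
  show "adj_matrix ?H (None # map Some vs) $$ (i, j) = ?B $$ (i, j)"
  proof (cases i; cases j)
    fix l assume "i = 0" "j = Suc l"
    then show ?thesis
      using ij mem[of l] by (simp add: adj_matrix_def bordered_mat_def new new_sign)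
  next
    fix k assume k: "i = Suc k" "j = 0"
    have "{Some (vs ! k), None} = {None, Some (vs ! k)}" by (rule insert_commute)
    then show ?thesis
      using k ij mem[of k] by (simp add: adj_matrix_def bordered_mat_def new new_sign)
  next
    fix k l assume "i = Suc k" "j = Suc l"
    then show ?thesis
      using ij by (simp add: adj_matrix_def bordered_mat_def old old_sign)
  qed (simp add: adj_matrix_def bordered_mat_def loop)
qed (simp_all add: bordered_mat_def adj_matrix_def)

lemma isomorphic_delete_add_vertex:
  "isomorphic (delete_vertex None (add_vertex s G)) G"
proof -
  have V: "verts (delete_vertex None (add_vertex s G)) = Some ` verts G"
    and E: "edges (delete_vertex None (add_vertex s G)) = (\<lambda>e. Some ` e) ` edges G"
    by (auto simp: delete_vertex_def add_vertex_def)
  have the_Some: "the ` Some ` e = e" for e :: "'a set"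
    by (simp add: image_comp comp_def)
  show ?thesis
    unfolding isomorphic_def V E
  \<comment> \<open>\<open>the\<close> inverts \<open>Some\<close>; its unspecified value at
    \<open>None\<close> is harmless because that vertex has been deleted.\<close>
  proof (intro exI[of _ the] conjI)
    show "bij_betw the (Some ` verts G) (verts G)"
      by (simp add: bij_betw_def inj_on_def the_Some)
    show "edges G = (\<lambda>e. the ` e) ` (\<lambda>e. Some ` e) ` edges G"
      by (simp add: image_comp comp_def)
    show "\<forall>e\<in>(\<lambda>e. Some ` e) ` edges G.
        sign G (the ` e) = sign (delete_vertex None (add_vertex s G)) e"
      by (auto simp: the_Some delete_vertex_def add_vertex_def Some_image_simps)
  qed
qed

section \<open>From the sign vector to the extended signed graph\<close>

theorem theorem5p2:
  fixes G :: "'a signed_graph" and lam :: real and m :: nat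
  assumes "is_signed_graph G"
    and "signed_spectrum G =
           replicate_mset m (- lam) + replicate_mset 1 0 + replicate_mset m lam"
    and "\<forall>v\<in>verts G. real (vdegree G v) = lam\<^sup>2 \<or> real (vdegree G v) = lam\<^sup>2 - 1"
  shows "\<exists>(H :: 'a option signed_graph) w.
           is_signed_graph H \<and>
           signed_spectrum H =
             replicate_mset (m + 1) (- lam) + replicate_mset (m + 1) lam \<and>
           w \<in> verts H \<and>
           isomorphic (delete_vertex w H) G"
proof -
  obtain vs where vs: "distinct vs" "set vs = verts G"
    using assms(1) finite_distinct_list unfolding is_signed_graph_def by metis
  define n where "n = length vs"
  define A where "A = adj_matrix G vs"
  have A: "A \<in> carrier_mat n n" and sym: "transpose_mat A = A"
    by (simp_all add: A_def n_def adj_matrix_carrier adj_matrix_symmetric)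
  have spec: "proots (char_poly A) = replicate_mset m (- lam) + replicate_mset 1 0 + replicate_mset m lam"
    using assms(2) signed_spectrum_eq[OF vs] by (simp add: A_def)
  \<comment> \<open>\<open>G\<close> has \<open>2 * m + 1\<close> vertices, so the border makes the
    order even.\<close>
  have n: "Suc n = 2 * (m + 1)"
    using symmetric_power_traces(1)[OF A sym] by (simp add: spec)
  have mem: "vs ! i \<in> verts G" if "i < n" for i
    using that unfolding n_def vs(2)[symmetric] by (rule nth_mem)
  have diag: "(A * A) $$ (i, i) = lam\<^sup>2 \<or> (A * A) $$ (i, i) = lam\<^sup>2 - 1" if "i < n" for i
    using assms(3) mem[OF that] adj_matrix_square_diag[OF assms(1) vs, of i] that
    by (simp add: A_def n_def)
  show ?thesis
  proof (rule extension_vector[OF A sym spec diag])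
    fix b
    assume b: "b \<in> carrier_vec n" "\<And>i. i < n \<Longrightarrow> b $ i \<in> {0, 1, -1}"
      and sq: "\<And>i k. i < n \<Longrightarrow> k < n \<Longrightarrow>
        (A * A) $$ (i, k) + b $ i * b $ k = (if i = k then lam\<^sup>2 else 0)"
      and Ab: "A *\<^sub>v b = 0\<^sub>v n" and bb: "b \<bullet> b = lam\<^sup>2"
    \<comment> \<open>Signs are integers but \<open>b\<close> is real; on the values 0, 1 and -1
      taking the floor loses nothing.\<close>
    have floor_b: "of_int \<lfloor>b $ i\<rfloor> = b $ i \<and> \<lfloor>b $ i\<rfloor> \<in> {0, 1, -1}" if "i < n" for i
      using b(2)[OF that] floor_of_int[of "-1", where 'a = real]
      by (auto simp del: of_int_floor_cancel)
    \<comment> \<open>The inverse of indexing, well defined as \<open>vs\<close> is distinct, turns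
      a vertex into its position and so transports \<open>b\<close> to the vertices.\<close>
    define s where "s v = \<lfloor>b $ the_inv_into {..<n} ((!) vs) v\<rfloor>" for v
    have "the_inv_into {..<n} ((!) vs) (vs ! i) = i" if "i < n" for i
      using that vs(1) by (intro the_inv_into_f_f) (auto simp: inj_on_def n_def nth_eq_iff_index_eq)
    then have s_nth: "s (vs ! i) = \<lfloor>b $ i\<rfloor>" if "i < n" for i
      using that by (simp add: s_def)
    have s: "s v \<in> {0, 1, -1}" if "v \<in> verts G" for v
    proof -
      have "v \<in> set vs" using that by (simp only: vs(2))
      then obtain i where i: "i < n" "vs ! i = v"
        unfolding in_set_conv_nth n_def by blast
      then have "s v = \<lfloor>b $ i\<rfloor>" using s_nth by blast
      then show ?thesis using floor_b[OF i(1)] by simp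
    qed
    have "vec n (\<lambda>i. of_int (s (vs ! i))) = b"
      using b(1) floor_b by (intro eq_vecI) (auto simp: s_nth)
    then have adj: "adj_matrix (add_vertex s G) (None # map Some vs) = bordered_mat b A"
      using adj_matrix_add_vertex[OF vs(2), of s] by (simp add: A_def n_def)
    \<comment> \<open>The spectrum does not depend on the vertex order, so it may be computed with
      the new vertex first.\<close>
    have "distinct (None # map Some vs)" "set (None # map Some vs) = verts (add_vertex s G)"
      using vs by (auto simp: distinct_map add_vertex_def)
    then have "signed_spectrum (add_vertex s G) = proots (char_poly (bordered_mat b A))"
      unfolding adj[symmetric] by (rule signed_spectrum_eq)
    also have "\<dots> = replicate_mset (m + 1) (- lam) + replicate_mset (m + 1) lam"
    proof (rule bordered_mat_spectrum[OF A sym b(1) _ Ab bb _ n])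
      show "mat_trace A = 0" unfolding A_def by (rule adj_matrix_trace[OF assms(1)])
    qed (rule sq)
    finally have "signed_spectrum (add_vertex s G)
        = replicate_mset (m + 1) (- lam) + replicate_mset (m + 1) lam" .
    moreover have "is_signed_graph (add_vertex s G)"
      using assms(1) s by (rule is_signed_graph_add_vertex)
    moreover have "None \<in> verts (add_vertex s G)" by (simp add: add_vertex_def)
    ultimately show ?thesis
      using isomorphic_delete_add_vertex[of s G] by blast
  qed
qed

end
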